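(* Let $(x^*,y^* )$ be a global standard optimistic solution of the bilevel problem. Then $x^*$ is a global $l$-minimal solution of the set-valued formulation, and $(x^*,F(x^*,y^* ))$ is a global vector solution of the set-valued formulation.
   Context: Setting. $\mathcal{X},\mathcal{Y}$ are real normed linear spaces, $X\subseteq\mathcal{X}$ is nonempty, $F:\mathcal{X}\times\mathcal{Y}\to\mathbb{R}$ is the upper-level objective. For each $x\in X$, $K(x)\subseteq\mathcal{Y}$ is the lower-level constraint set, $f$ is the real-valued lower-level objective, and $\psi(x)=\arg\min_y\{f(x,y)\mid y\in K(x)\}$ is the set of global minimizers of $f(x,\cdot)$ over $K(x)$. Standing assumption: $\psi(x)\neq\emptyset$ for every $x\in X$. The bilevel problem is: "minimize" over $x$ the value $F(x,y)$ subject to $x\in X$, $y\in\psi(x)$. A point $(x^*,y^* )$ is a global standard optimistic solution of the bilevel problem if $x^*\in X$, $y^*\in\psi(x^* )$ and $F(x,y)\ge F(x^*,y^* )$ for all $x\in X$ and $y\in\psi(x)$. Set-valued formulation: minimize $F(x,\psi(x))$ over $x\in X$, where $F(x,\psi(x)):=\{F(x,y)\mid y\in\psi(x)\}\subseteq\mathbb{R}$. $\mathbb{R}$ carries its usual order, induced by the cone $C=\mathbb{R}_+=[0,\infty)$. For nonempty $A,B\subseteq\mathbb{R}$, $A\le_C^l B$ means $B\subseteq A+C$. A point $x^0\in X$ is a global $l$-minimal solution of the set-valued formulation if for every $x\in X$ with $F(x,\psi(x))\le_C^l F(x^0,\psi(x^0))$ one has $F(x^0,\psi(x^0))\le_C^l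 F(x,\psi(x))$. A pair $(x^0,z^0)\in X\times\mathbb{R}$ is a global vector solution of the set-valued formulation if $z^0\in F(x^0,\psi(x^0))$ and $z^0$ is a minimal element of $\bigcup_{x\in X}F(x,\psi(x))$ with respect to the usual order of $\mathbb{R}$. *)

theory Defs
  imports "HOL-Analysis.Analysis" "HOL-Library.Set_Algebras"
begin

(* K and f are total functions; only their values at points of the upper-level
   feasible set X are ever used. *)
definition lower_solutions ::
  "('a \<times> 'b \<Rightarrow> real) \<Rightarrow> ('a \<Rightarrow> 'b set) \<Rightarrow> 'a \<Rightarrow> 'b set" where
  "lower_solutions f K x = {y. is_arg_min (\<lambda>y. f (x, y)) (\<lambda>y. y \<in> K x) y}"

definition global_standard_optimistic_solution ::
  "'a set \<Rightarrow> ('a \<times> 'b \<Rightarrow> real) \<Rightarrow> ('a \<Rightarrow> 'b set) \<Rightarrow> 'a \<Rightarrow> 'b \<Rightarrow> bool" where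
  "global_standard_optimistic_solution X F \<psi> x0 y0 \<longleftrightarrow>
     x0 \<in> X \<and> y0 \<in> \<psi> x0 \<and> (\<forall>x\<in>X. \<forall>y\<in>\<psi> x. F (x, y) \<ge> F (x0, y0))"

definition set_objective ::
  "('a \<times> 'b \<Rightarrow> real) \<Rightarrow> ('a \<Rightarrow> 'b set) \<Rightarrow> 'a \<Rightarrow> real set" where
  "set_objective F \<psi> x = {F (x, y) |y. y \<in> \<psi> x}"

definition ordering_cone :: "real set" where
  "ordering_cone = {0..}"

(* The sum of sets is the elementwise (Minkowski) sum.  The relation is meant for
   nonempty A and B. *)
definition lower_set_le :: "real set \<Rightarrow> real set \<Rightarrow> bool" where
  "lower_set_le A B \<longleftrightarrow> B \<subseteq> A + ordering_cone"

definition global_l_minimal_solution ::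
  "'a set \<Rightarrow> ('a \<Rightarrow> real set) \<Rightarrow> 'a \<Rightarrow> bool" where
  "global_l_minimal_solution X G x0 \<longleftrightarrow>
     x0 \<in> X \<and> (\<forall>x\<in>X. lower_set_le (G x) (G x0) \<longrightarrow> lower_set_le (G x0) (G x))"

definition minimal_element :: "'c::order set \<Rightarrow> 'c \<Rightarrow> bool" where
  "minimal_element M z0 \<longleftrightarrow> z0 \<in> M \<and> (\<forall>z\<in>M. z \<le> z0 \<longrightarrow> z = z0)"

definition global_vector_solution ::
  "'a set \<Rightarrow> ('a \<Rightarrow> real set) \<Rightarrow> 'a \<Rightarrow> real \<Rightarrow> bool" where
  "global_vector_solution X G x0 z0 \<longleftrightarrow>
     x0 \<in> X \<and> z0 \<in> G x0 \<and> minimal_element (\<Union>x\<in>X. G x) z0"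

end

theory Submission
  imports Defs
begin

text \<open>Optimism makes \<open>F (xs, ys)\<close> the least element of the union of all image sets
  of the set-valued objective, and this value is attained in the image set of \<open>xs\<close>.
  On the real line the lower set order \<open>lower_set_le A B\<close> holds as soon as one point of \<open>A\<close>
  bounds \<open>B\<close> from below (\<open>lower_set_leI\<close>), so the image set of \<open>xs\<close> precedes every other one;
  this is stronger than \<open>l\<close>-minimality, which asks for it only against image sets that precede
  that of \<open>xs\<close>.  The vector statement holds because a least element is minimal.\<close>

lemma lower_set_leI:
  assumes "a \<in> A" and "\<And>b. b \<in> B \<Longrightarrow> a \<le> b"
  shows "lower_set_le A B"
  unfolding lower_set_le_def
proof
  fix b assume "b \<in> B"
  then have "b - a \<in> ordering_cone"
    using assms(2) by (simp add: ordering_cone_def)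
  with assms(1) have "a + (b - a) \<in> A + ordering_cone"
    by (rule set_plus_intro)
  then show "b \<in> A + ordering_cone" by simp
qed

lemma least_value_imp_l_minimal:
  assumes "x0 \<in> X" and "z0 \<in> G x0" and "\<And>x z. x \<in> X \<Longrightarrow> z \<in> G x \<Longrightarrow> z0 \<le> z"
  shows "global_l_minimal_solution X G x0"
  unfolding global_l_minimal_solution_def
  using assms by (blast intro: lower_set_leI)

lemma least_value_imp_vector_solution:
  assumes "x0 \<in> X" and "z0 \<in> G x0" and "\<And>x z. x \<in> X \<Longrightarrow> z \<in> G x \<Longrightarrow> z0 \<le> z"
  shows "global_vector_solution X G x0 z0"
  unfolding global_vector_solution_def minimal_element_def
  using assms by (blast intro: order_antisym)

theorem proposition9:
  fixes X :: "'a::real_normed_vector set"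
    and K :: "'a \<Rightarrow> 'b::real_normed_vector set"
    and F f :: "'a \<times> 'b \<Rightarrow> real"
    and xs :: 'a and ys :: 'b
  assumes "X \<noteq> {}"
    and "\<forall>x\<in>X. lower_solutions f K x \<noteq> {}"
    and "global_standard_optimistic_solution X F (lower_solutions f K) xs ys"
  shows "global_l_minimal_solution X (set_objective F (lower_solutions f K)) xs
       \<and> global_vector_solution X (set_objective F (lower_solutions f K)) xs (F (xs, ys))"
proof -
  let ?G = "set_objective F (lower_solutions f K)"
  have "xs \<in> X" and "F (xs, ys) \<in> ?G xs"
    and "\<And>x z. x \<in> X \<Longrightarrow> z \<in> ?G x \<Longrightarrow> F (xs, ys) \<le> z"
    using assms(3) by (auto simp: global_standard_optimistic_solution_def set_objective_def)
  then show ?thesis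
    by (intro conjI least_value_imp_l_minimal least_value_imp_vector_solution)
qed

end
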